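(* Let $\Sigma$ be a finite set, let $p\in\Delta(\Sigma)$ have full support, let $g\in\mathbb{R}^{\Sigma}$ be a non-constant vector, and let $\varepsilon>0$. Consider the optimization problem $$\max_{q\in\Delta(\Sigma)}\ g\cdot q\quad\text{subject to}\quad \mathrm{KL}(q\|p)\le\varepsilon .$$ For $\delta\ge 0$ define $q_\delta(g)\in\Delta(\Sigma)$ by $$q_\delta(g)_u:=\frac{p_u e^{\delta g_u}}{Z_g(\delta)},\qquad Z_g(\delta):=\sum_{v\in\Sigma}p_v e^{\delta g_v},$$ and let $$M(g):=\arg\max_{u\in\Sigma} g_u\subseteq\Sigma,\qquad \varepsilon_{\max}(g):=-\log\Big(\sum_{u\in M(g)}p_u\Big).$$ Then: (1) If $0<\varepsilon<\varepsilon_{\max}(g)$, there exists a unique $\delta\in(0,\infty)$ such that $\mathrm{KL}(q_\delta(g)\|p)=\varepsilon$. Moreover, the optimizer of the problem is unique and equals $q_\delta(g)$ for this $\delta$, i.e. it is proportional to $p\,e^{\delta g}$ (coordinatewise). (2) If $\varepsilon\ge\varepsilon_{\max}(g)$, the distribution $$q_\infty(g)_u:=\frac{p_u\,\mathbf{1}\{u\in M(g)\}}{\sum_{v\in M(g)}p_v},\qquad u\in\Sigma,$$ is optimal.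
   Context: $\Delta(\Sigma)$ is the set of probability vectors $q=(q_u)_{u\in\Sigma}$ on the finite set $\Sigma$; full support means $p_u>0$ for all $u$. The dot product is $g\cdot q=\sum_{u\in\Sigma}g_uq_u$. $\mathrm{KL}(q\|p)=\sum_{u\in\Sigma}q_u\log\frac{q_u}{p_u}$ with the convention $0\log 0=0$. *)

theory Defs
  imports "HOL-Analysis.Analysis"
begin

text \<open>The finite set \<open>\<Sigma>\<close> is the index type \<open>'a\<close>, so that \<open>\<real>\<^sup>\<Sigma>\<close> is \<open>real ^ 'a\<close> and the
  dot product is the library's inner product.\<close>

definition prob_vectors :: "(real ^ 'a) set" where
  "prob_vectors = {q. (\<forall>u. 0 \<le> q $ u) \<and> (\<Sum>u\<in>UNIV. q $ u) = 1}"

definition full_support :: "real ^ 'a \<Rightarrow> bool" where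
  "full_support p \<longleftrightarrow> (\<forall>u. 0 < p $ u)"

text \<open>The convention \<open>0 log 0 = 0\<close> holds because the factor \<open>q $ u\<close> vanishes. If \<open>p $ u = 0 < q $ u\<close>
  the summand is \<open>0\<close> (division by zero) rather than infinite, so the definition is meaningful
  only for \<open>p\<close> of full support.\<close>

definition KL :: "real ^ 'a \<Rightarrow> real ^ 'a \<Rightarrow> real" where
  "KL q p = (\<Sum>u\<in>UNIV. q $ u * ln (q $ u / p $ u))"

definition kl_feasible :: "real ^ 'a \<Rightarrow> real \<Rightarrow> real ^ 'a \<Rightarrow> bool" where
  "kl_feasible p \<epsilon> q \<longleftrightarrow> q \<in> prob_vectors \<and> KL q p \<le> \<epsilon>"

definition kl_optimal :: "real ^ 'a \<Rightarrow> real ^ 'a \<Rightarrow> real \<Rightarrow> real ^ 'a \<Rightarrow> bool" where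
  "kl_optimal p g \<epsilon> q \<longleftrightarrow> is_arg_max (\<lambda>q. g \<bullet> q) (kl_feasible p \<epsilon>) q"

definition tilt_Z :: "real ^ 'a \<Rightarrow> real ^ 'a \<Rightarrow> real \<Rightarrow> real" where
  "tilt_Z p g \<delta> = (\<Sum>v\<in>UNIV. p $ v * exp (\<delta> * g $ v))"

definition tilt :: "real ^ 'a \<Rightarrow> real ^ 'a \<Rightarrow> real \<Rightarrow> real ^ 'a" where
  "tilt p g \<delta> = (\<chi> u. p $ u * exp (\<delta> * g $ u) / tilt_Z p g \<delta>)"

definition maximizers :: "real ^ 'a \<Rightarrow> 'a set" where
  "maximizers g = {u. is_arg_max (\<lambda>v. g $ v) (\<lambda>_. True) u}"

definition eps_max :: "real ^ 'a \<Rightarrow> real ^ 'a \<Rightarrow> real" where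
  "eps_max p g = - ln (\<Sum>u\<in>maximizers g. p $ u)"

definition tilt_infinity :: "real ^ 'a \<Rightarrow> real ^ 'a \<Rightarrow> real ^ 'a" where
  "tilt_infinity p g =
    (\<chi> u. p $ u * indicator (maximizers g) u / (\<Sum>v\<in>maximizers g. p $ v))"

lemma tilt_in_prob_vectors:
  assumes "full_support p"
  shows "tilt p g \<delta> \<in> prob_vectors"
proof -
  have pos: "0 < tilt_Z p g \<delta>"
    unfolding tilt_Z_def using assms by (intro sum_pos) (auto simp: full_support_def)
  have "(\<Sum>u\<in>UNIV. tilt p g \<delta> $ u) = tilt_Z p g \<delta> / tilt_Z p g \<delta>"
    unfolding tilt_def by (simp add: tilt_Z_def flip: sum_divide_distrib)
  moreover have "0 \<le> tilt p g \<delta> $ u" for u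
    using assms pos by (simp add: tilt_def full_support_def less_imp_le)
  ultimately show ?thesis
    using pos by (simp add: prob_vectors_def)
qed

end

(* Write q_d for tilt p g d and Z for tilt_Z p g.  Every probability vector q satisfies
   KL(q|p) = KL(q|q_d) + d (g . q) - log Z(d).  With Gibbs' inequality (KL(q|r) >= 0, with equality
   only for q = r) this identity gives the optimality and uniqueness of q_d at the level KL(q_d|p),
   and also, without derivatives, the strict monotonicity of KL(q_d|p) in d >= 0.  That function is
   continuous, vanishes at d = 0 and tends to eps_max, so the intermediate value theorem supplies d. *)
theory Submission
  imports Defs
begin

section \<open>Gibbs' inequality\<close>

lemma diff_le_mult_ln_div:
  fixes x y :: real
  assumes "0 \<le> x" "0 < y"
  shows "x - y \<le> x * ln (x / y)"
    and "x - y = x * ln (x / y) \<Longrightarrow> x = y"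
proof -
  have "x - y \<le> x * ln (x / y) \<and> (x - y = x * ln (x / y) \<longrightarrow> x = y)"
  proof (cases "x = 0")
    case False
    with assms have pos: "0 < x" by simp
    have ln: "ln (x / y) = - ln (y / x)"
      using pos assms by (simp add: ln_div)
    \<comment> \<open>Both claims rest on \<open>ln t \<le> t - 1\<close> at
      \<open>t = y / x\<close>, where equality forces \<open>t = 1\<close>.\<close>
    have "ln (y / x) \<le> y / x - 1"
      using pos assms by (intro ln_le_minus_one) simp
    then have "x * ln (y / x) \<le> x * (y / x - 1)"
      using pos by (intro mult_left_mono) auto
    moreover have eq: "x * (y / x - 1) = y - x"
      using pos by (simp add: field_simps)
    moreover have "x = y" if "x - y = x * ln (x / y)"
    proof -
      have "x * ln (y / x) = x * (y / x - 1)"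
        using that unfolding eq by (simp add: ln)
      then have "ln (y / x) = y / x - 1"
        using pos by simp
      then have "y / x = 1"
        using pos assms by (intro ln_eq_minus_one) auto
      then show ?thesis using pos by simp
    qed
    ultimately show ?thesis by (simp add: ln)
  qed (use assms in auto)
  then show "x - y \<le> x * ln (x / y)" and "x - y = x * ln (x / y) \<Longrightarrow> x = y"
    by auto
qed

text \<open>Summing the pointwise bound suffices: the differences \<open>q $ u - r $ u\<close> add
  up to 1 - 1 = 0.\<close>

lemma KL_nonneg:
  assumes "q \<in> prob_vectors" "r \<in> prob_vectors" "full_support r"
  shows "0 \<le> KL q r"
proof -
  have "(\<Sum>u\<in>UNIV. q $ u - r $ u) \<le> KL q r"
    unfolding KL_def using assms
    by (intro sum_mono diff_le_mult_ln_div) (auto simp: prob_vectors_def full_support_def)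
  then show ?thesis
    using assms by (simp add: prob_vectors_def sum_subtractf)
qed

lemma KL_le_zero_imp_eq:
  assumes q: "q \<in> prob_vectors" and r: "r \<in> prob_vectors" "full_support r"
    and "KL q r \<le> 0"
  shows "q = r"
proof -
  \<comment> \<open>The slack in the pointwise bound. The slacks are nonnegative with sum
    \<open>KL q r\<close>, so they all vanish and the equality case applies to each
    coordinate.\<close>
  define d where "d u = q $ u * ln (q $ u / r $ u) - (q $ u - r $ u)" for u
  have d: "0 \<le> d u" for u
    unfolding d_def using q r diff_le_mult_ln_div(1)[of "q $ u" "r $ u"]
    by (auto simp: prob_vectors_def full_support_def)
  have "sum d UNIV = KL q r"
    using q r by (simp add: d_def KL_def prob_vectors_def sum_subtractf)
  with assms(4) have "sum d UNIV = 0"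
    using sum_nonneg[of UNIV d] d by fastforce
  then have "d u = 0" for u
    using d by (simp add: sum_nonneg_eq_0_iff)
  then have "q $ u = r $ u" for u
    using q r diff_le_mult_ln_div(2)[of "q $ u" "r $ u"]
    by (simp add: d_def prob_vectors_def full_support_def)
  then show ?thesis by (simp add: vec_eq_iff)
qed

section \<open>Exponential tilts\<close>

lemma tilt_Z_pos: "full_support p \<Longrightarrow> 0 < tilt_Z p g \<delta>"
  unfolding tilt_Z_def by (intro sum_pos) (auto simp: full_support_def)

lemma full_support_tilt: "full_support p \<Longrightarrow> full_support (tilt p g \<delta>)"
  using tilt_Z_pos[of p g \<delta>] by (simp add: full_support_def tilt_def)

text \<open>The log-ratio of the tilt to \<open>p\<close> is affine in \<open>g\<close>, namely
  \<open>\<delta> * g $ u - ln (tilt_Z p g \<delta>)\<close>; averaging it under \<open>q\<close>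
  gives the correction terms.\<close>

lemma KL_tilt_decomposition:
  assumes "full_support p" "q \<in> prob_vectors"
  shows "KL q p = KL q (tilt p g \<delta>) + \<delta> * (g \<bullet> q) - ln (tilt_Z p g \<delta>)"
proof -
  note Z = tilt_Z_pos[OF assms(1), of g \<delta>]
  have "q $ u * ln (q $ u / p $ u) =
      q $ u * ln (q $ u / tilt p g \<delta> $ u) + \<delta> * (g $ u * q $ u) - q $ u * ln (tilt_Z p g \<delta>)" for u
  proof (cases "q $ u = 0")
    case False
    with assms have "0 < q $ u" "0 < p $ u"
      by (auto simp: prob_vectors_def full_support_def less_le)
    then show ?thesis
      using Z by (simp add: tilt_def ln_div ln_mult algebra_simps)
  qed simp
  then have "KL q p = KL q (tilt p g \<delta>) + \<delta> * (g \<bullet> q) - (\<Sum>u\<in>UNIV. q $ u) * ln (tilt_Z p g \<delta>)"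
    by (simp add: KL_def inner_vec_def sum.distrib sum_subtractf sum_distrib_left sum_distrib_right)
  then show ?thesis
    using assms(2) by (simp add: prob_vectors_def)
qed

lemma KL_self: "full_support p \<Longrightarrow> KL p p = 0"
  by (simp add: KL_def full_support_def less_le)

lemma KL_tilt:
  assumes "full_support p"
  shows "KL (tilt p g \<delta>) p = \<delta> * (g \<bullet> tilt p g \<delta>) - ln (tilt_Z p g \<delta>)"
  using KL_tilt_decomposition[OF assms tilt_in_prob_vectors[OF assms], of g \<delta> g \<delta>]
  by (simp add: KL_self full_support_tilt assms)

text \<open>Non-constancy of \<open>g\<close> enters here: if two different parameters give the same
  tilt, comparing logarithms expresses every \<open>g $ u\<close> by the same number.\<close>

lemma inj_tilt:
  assumes p: "full_support p" and g: "\<not> (\<exists>c. \<forall>u. g $ u = c)"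
  shows "inj (tilt p g)"
proof (rule injI)
  fix s t
  assume eq: "tilt p g s = tilt p g t"
  show "s = t"
  proof (rule ccontr)
    assume "s \<noteq> t"
    have "g $ u = (ln (tilt_Z p g s) - ln (tilt_Z p g t)) / (s - t)" for u
    proof -
      have "0 < p $ u" using p by (simp add: full_support_def)
      moreover have "ln (tilt p g s $ u) = ln (tilt p g t $ u)" using eq by simp
      ultimately have "s * g $ u - ln (tilt_Z p g s) = t * g $ u - ln (tilt_Z p g t)"
        using tilt_Z_pos[OF p, of g s] tilt_Z_pos[OF p, of g t]
        by (simp add: tilt_def ln_div ln_mult)
      then show ?thesis using \<open>s \<noteq> t\<close> by (simp add: field_simps)
    qed
    with g show False by blast
  qed
qed

lemma KL_tilt_strict_mono:
  assumes p: "full_support p" and g: "\<not> (\<exists>c. \<forall>u. g $ u = c)"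
    and "0 \<le> s" "s < t"
  shows "KL (tilt p g s) p < KL (tilt p g t) p"
proof -
  let ?q = "tilt p g s" and ?r = "tilt p g t"
  note P = tilt_in_prob_vectors[OF p] and F = full_support_tilt[OF p]
  have "?q \<noteq> ?r"
    using inj_tilt[OF p g] \<open>s < t\<close> by (auto dest: injD)
  then have pos: "0 < KL ?r ?q" "0 < KL ?q ?r"
    using KL_le_zero_imp_eq[OF P P F, of g t g s] KL_le_zero_imp_eq[OF P P F, of g s g t]
    by force+
  \<comment> \<open>Each tilt is decomposed around the other; on adding, the log-partition terms
    cancel. Positivity of the left side makes \<open>g \<bullet> tilt p g \<delta>\<close> strictly
    increasing in \<open>\<delta>\<close>.\<close>
  have "KL ?r ?q + KL ?q ?r = (t - s) * (g \<bullet> ?r - g \<bullet> ?q)"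
    using KL_tilt_decomposition[OF p P, of g t g s] KL_tilt_decomposition[OF p P, of g s g t]
      KL_tilt[OF p, of g s] KL_tilt[OF p, of g t]
    by (simp add: algebra_simps)
  with pos have "0 < (t - s) * (g \<bullet> ?r - g \<bullet> ?q)" by linarith
  with \<open>s < t\<close> have "0 < g \<bullet> ?r - g \<bullet> ?q" by (simp add: zero_less_mult_iff)
  with \<open>0 \<le> s\<close> have "0 \<le> s * (g \<bullet> ?r - g \<bullet> ?q)" by simp
  \<comment> \<open>The first summand is positive, and the second is nonnegative because
    \<open>0 \<le> s\<close>.\<close>
  moreover have "KL ?r p - KL ?q p = KL ?r ?q + s * (g \<bullet> ?r - g \<bullet> ?q)"
    using KL_tilt_decomposition[OF p P, of g t g s] KL_tilt[OF p, of g s]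
    by (simp add: algebra_simps)
  ultimately show ?thesis using pos by linarith
qed

lemma continuous_on_KL_tilt:
  assumes "full_support p"
  shows "continuous_on S (\<lambda>\<delta>. KL (tilt p g \<delta>) p)"
proof -
  have "tilt_Z p g \<delta> \<noteq> 0" for \<delta>
    using tilt_Z_pos[OF assms, of g \<delta>] by simp
  then show ?thesis
    unfolding KL_tilt[OF assms]
    by (auto simp: tilt_def inner_vec_def tilt_Z_def intro!: continuous_intros)
qed

section \<open>Maximizers and the limit of large tilts\<close>

lemma maximizers_iff: "u \<in> maximizers g \<longleftrightarrow> (\<forall>v. g $ v \<le> g $ u)"
  by (auto simp: maximizers_def is_arg_max_def not_less)

lemma maximizers_nonempty: "maximizers g \<noteq> {}"
proof -
  have "Max (range (($) g)) \<in> range (($) g)" by (intro Max_in) auto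
  then obtain u where "Max (range (($) g)) = g $ u" by blast
  moreover have "g $ v \<le> Max (range (($) g))" for v by simp
  ultimately have "u \<in> maximizers g" by (simp add: maximizers_iff)
  then show ?thesis by blast
qed

lemma sum_maximizers_pos: "full_support p \<Longrightarrow> 0 < (\<Sum>u\<in>maximizers g. p $ u)"
  using maximizers_nonempty[of g] by (intro sum_pos) (auto simp: full_support_def)

(* With m the maximum of g, the exponents are nonpositive, so each sum has a limit as \<delta> grows. *)
lemma KL_tilt_shift:
  assumes "full_support p"
  shows "KL (tilt p g \<delta>) p =
    (\<Sum>u\<in>UNIV. p $ u * (\<delta> * (g $ u - m) * exp (\<delta> * (g $ u - m)))) /
      (\<Sum>u\<in>UNIV. p $ u * exp (\<delta> * (g $ u - m)))
    - ln (\<Sum>u\<in>UNIV. p $ u * exp (\<delta> * (g $ u - m)))"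
proof -
  define W where "W = (\<Sum>u\<in>UNIV. p $ u * exp (\<delta> * (g $ u - m)))"
  have Z: "tilt_Z p g \<delta> = exp (\<delta> * m) * W"
    by (simp add: tilt_Z_def W_def sum_distrib_left exp_add[symmetric] algebra_simps)
  with tilt_Z_pos[OF assms, of g \<delta>] have W: "0 < W"
    by (simp add: zero_less_mult_iff)
  have tilt: "tilt p g \<delta> $ u = p $ u * exp (\<delta> * (g $ u - m)) / W" for u
    by (simp add: tilt_def Z right_diff_distrib exp_diff)
  have sum1: "(\<Sum>u\<in>UNIV. tilt p g \<delta> $ u) = 1"
    using tilt_in_prob_vectors[OF assms] by (simp add: prob_vectors_def)
  have "\<delta> * (g \<bullet> tilt p g \<delta>) - \<delta> * m =
      \<delta> * (g \<bullet> tilt p g \<delta>) - \<delta> * m * (\<Sum>u\<in>UNIV. tilt p g \<delta> $ u)"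
    using sum1 by simp
  also have "\<dots> = (\<Sum>u\<in>UNIV. \<delta> * (g $ u - m) * tilt p g \<delta> $ u)"
    by (simp add: inner_vec_def sum_distrib_left sum_subtractf[symmetric] algebra_simps)
  also have "\<dots> = (\<Sum>u\<in>UNIV. p $ u * (\<delta> * (g $ u - m) * exp (\<delta> * (g $ u - m)))) / W"
    by (simp add: tilt sum_divide_distrib mult_ac)
  finally show ?thesis
    unfolding KL_tilt[OF assms] Z W_def[symmetric] using W by (simp add: ln_mult)
qed

lemma tendsto_exp_mult_neg:
  fixes c :: real
  assumes "c < 0"
  shows "((\<lambda>x. exp (x * c)) \<longlongrightarrow> 0) at_top"
    and "((\<lambda>x. x * c * exp (x * c)) \<longlongrightarrow> 0) at_top"
proof -
  \<comment> \<open>With \<open>y = - c * x\<close>, the two functions are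
    \<open>y ^ 0 / exp y\<close> and \<open>- (y ^ 1 / exp y)\<close>.\<close>
  have lim: "filterlim (\<lambda>x. - c * x) at_top at_top"
    using assms by (intro filterlim_tendsto_pos_mult_at_top[OF tendsto_const] filterlim_ident) auto
  show "((\<lambda>x. exp (x * c)) \<longlongrightarrow> 0) at_top"
    using filterlim_compose[OF tendsto_power_div_exp_0[of 0] lim]
    by (simp add: exp_minus divide_inverse mult.commute)
  show "((\<lambda>x. x * c * exp (x * c)) \<longlongrightarrow> 0) at_top"
    using tendsto_minus[OF filterlim_compose[OF tendsto_power_div_exp_0[of 1] lim]]
    by (simp add: exp_minus divide_inverse mult_ac)
qed

text \<open>In the shifted formula the terms off the maximizers decay, while on them the exponent is
  0. So the normalizing sum tends to \<open>P\<close>, the numerator to 0, and \<open>- ln P\<close>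
  remains.\<close>

lemma KL_tilt_tendsto:
  assumes p: "full_support p"
  shows "((\<lambda>\<delta>. KL (tilt p g \<delta>) p) \<longlongrightarrow> eps_max p g) at_top"
proof -
  obtain w where w: "w \<in> maximizers g" using maximizers_nonempty by blast
  define m where "m = g $ w"
  define P where "P = (\<Sum>u\<in>maximizers g. p $ u)"
  have M: "u \<in> maximizers g \<longleftrightarrow> g $ u = m" and le: "g $ u \<le> m" for u
    using w by (auto simp: maximizers_iff m_def intro: antisym)
  have "((\<lambda>\<delta>. p $ u * exp (\<delta> * (g $ u - m))) \<longlongrightarrow> (if u \<in> maximizers g then p $ u else 0)) at_top"
    for u
    using le[of u] tendsto_mult_right_zero[OF tendsto_exp_mult_neg(1)[of "g $ u - m"]]
    by (cases "g $ u = m") (auto simp: M)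
  then have "((\<lambda>\<delta>. \<Sum>u\<in>UNIV. p $ u * exp (\<delta> * (g $ u - m)))
      \<longlongrightarrow> (\<Sum>u\<in>UNIV. if u \<in> maximizers g then p $ u else 0)) at_top"
    by (intro tendsto_sum)
  then have 1: "((\<lambda>\<delta>. \<Sum>u\<in>UNIV. p $ u * exp (\<delta> * (g $ u - m))) \<longlongrightarrow> P) at_top"
    by (simp add: P_def sum.If_cases)
  have "((\<lambda>\<delta>. p $ u * (\<delta> * (g $ u - m) * exp (\<delta> * (g $ u - m)))) \<longlongrightarrow> 0) at_top" for u
    using le[of u] tendsto_mult_right_zero[OF tendsto_exp_mult_neg(2)[of "g $ u - m"]]
    by (cases "g $ u = m") auto
  then have 2: "((\<lambda>\<delta>. \<Sum>u\<in>UNIV. p $ u * (\<delta> * (g $ u - m) * exp (\<delta> * (g $ u - m)))) \<longlongrightarrow> 0) at_top"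
    by (intro tendsto_null_sum)
  have "P \<noteq> 0" using sum_maximizers_pos[OF p, of g] by (simp add: P_def)
  from tendsto_diff[OF tendsto_divide[OF 2 1 this] tendsto_ln[OF 1 this]]
  show ?thesis
    unfolding KL_tilt_shift[OF p, where m = m] eps_max_def P_def[symmetric] by simp
qed

section \<open>The parameter at level \<open>\<epsilon>\<close>\<close>

lemma ex1_tilt_KL_eq:
  assumes p: "p \<in> prob_vectors" "full_support p" and g: "\<not> (\<exists>c. \<forall>u. g $ u = c)"
    and e: "0 < \<epsilon>" "\<epsilon> < eps_max p g"
  shows "\<exists>!\<delta>. 0 < \<delta> \<and> KL (tilt p g \<delta>) p = \<epsilon>"
proof -
  have "tilt p g 0 = p"
    using p by (simp add: tilt_def tilt_Z_def prob_vectors_def vec_eq_iff)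
  then have 0: "KL (tilt p g 0) p = 0" by (simp add: KL_self p)
  \<comment> \<open>The limit \<open>eps_max p g\<close> exceeds \<open>\<epsilon>\<close>, so some
    positive \<open>b\<close> overshoots it; together with the value 0 at 0 this brackets
    \<open>\<epsilon>\<close>.\<close>
  have "\<forall>\<^sub>F \<delta> in at_top. 0 < \<delta> \<and> \<epsilon> < KL (tilt p g \<delta>) p"
    using order_tendstoD(1)[OF KL_tilt_tendsto[OF p(2)] e(2)] eventually_gt_at_top[of 0]
    by eventually_elim simp
  then obtain b where b: "0 < b" "\<epsilon> < KL (tilt p g b) p"
    using eventually_happens'[OF trivial_limit_at_top_linorder] by blast
  obtain \<delta> where "0 \<le> \<delta>" "KL (tilt p g \<delta>) p = \<epsilon>"
    using IVT'[of "\<lambda>\<delta>. KL (tilt p g \<delta>) p" 0 \<epsilon> b] 0 e b continuous_on_KL_tilt[OF p(2)] by auto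
  moreover from this 0 e have "\<delta> \<noteq> 0" by auto
  moreover have "s = t" if "0 < s \<and> KL (tilt p g s) p = \<epsilon>" "0 < t \<and> KL (tilt p g t) p = \<epsilon>" for s t
    using that KL_tilt_strict_mono[OF p(2) g, of s t] KL_tilt_strict_mono[OF p(2) g, of t s]
    by (cases s t rule: linorder_cases) auto
  ultimately show ?thesis by (metis order_le_less)
qed

section \<open>Optimality in the two regimes\<close>

lemma kl_optimal_iff_eq_tilt:
  assumes p: "full_support p" and "0 < \<delta>" and e: "KL (tilt p g \<delta>) p = \<epsilon>"
  shows "kl_optimal p g \<epsilon> q \<longleftrightarrow> q = tilt p g \<delta>"
proof -
  let ?r = "tilt p g \<delta>"
  note r = tilt_in_prob_vectors[OF p, of g \<delta>] full_support_tilt[OF p, of g \<delta>]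
  \<comment> \<open>Subtracting the formula for \<open>KL ?r p = \<epsilon>\<close> from the
    decomposition of \<open>KL q p \<le> \<epsilon>\<close> cancels the log-partition term. The loss
    in objective thus controls the divergence from \<open>?r\<close>.\<close>
  have gap: "KL q ?r \<le> \<delta> * (g \<bullet> ?r - g \<bullet> q)" if "kl_feasible p \<epsilon> q" for q
    using that KL_tilt_decomposition[OF p, of q g \<delta>] KL_tilt[OF p, of g \<delta>] e
    by (simp add: kl_feasible_def algebra_simps)
  have le: "g \<bullet> q \<le> g \<bullet> ?r" if "kl_feasible p \<epsilon> q" for q
  proof -
    have "0 \<le> KL q ?r" using KL_nonneg[OF _ r] that by (simp add: kl_feasible_def)
    with gap[OF that] have "0 \<le> \<delta> * (g \<bullet> ?r - g \<bullet> q)" by linarith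
    with \<open>0 < \<delta>\<close> show ?thesis by (simp add: zero_le_mult_iff)
  qed
  have feas: "kl_feasible p \<epsilon> ?r" using r e by (simp add: kl_feasible_def)
  show ?thesis
  proof
    assume "kl_optimal p g \<epsilon> q"
    then have q: "kl_feasible p \<epsilon> q" and "g \<bullet> ?r \<le> g \<bullet> q"
      using feas by (auto simp: kl_optimal_def is_arg_max_def not_less)
    \<comment> \<open>The objective values agree, so the bound in \<open>gap\<close> is 0.\<close>
    with le[OF q] gap[OF q] have "KL q ?r \<le> 0" by simp
    then show "q = ?r" using KL_le_zero_imp_eq[OF _ r] q by (simp add: kl_feasible_def)
  next
    assume "q = ?r"
    then show "kl_optimal p g \<epsilon> q"
      using feas le by (auto simp: kl_optimal_def is_arg_max_def not_less)
  qed
qed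

lemma kl_optimal_tilt_infinity:
  assumes p: "full_support p" and e: "eps_max p g \<le> \<epsilon>"
  shows "kl_optimal p g \<epsilon> (tilt_infinity p g)"
proof -
  let ?q = "tilt_infinity p g"
  obtain w where w: "w \<in> maximizers g" using maximizers_nonempty by blast
  define P where "P = (\<Sum>u\<in>maximizers g. p $ u)"
  have P: "0 < P" using sum_maximizers_pos[OF p] by (simp add: P_def)
  have q: "?q $ u = (if u \<in> maximizers g then p $ u / P else 0)" for u
    by (simp add: tilt_infinity_def P_def)
  have sum: "(\<Sum>u\<in>UNIV. ?q $ u) = 1"
    using P by (simp add: q sum.If_cases P_def flip: sum_divide_distrib)
  have prob: "?q \<in> prob_vectors"
    using sum p P by (auto simp: prob_vectors_def q full_support_def less_imp_le)
  \<comment> \<open>On the maximizers the ratio is the constant \<open>1 / P\<close>, whose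
    logarithm is \<open>eps_max p g\<close>; elsewhere both sides are 0.\<close>
  have "?q $ u * ln (?q $ u / p $ u) = ?q $ u * eps_max p g" for u
  proof -
    have "p $ u \<noteq> 0" using p by (simp add: full_support_def less_le)
    then show ?thesis using P by (simp add: q eps_max_def P_def[symmetric] ln_div)
  qed
  then have "KL ?q p = eps_max p g"
    by (simp only: KL_def sum mult_1 flip: sum_distrib_right)
  with prob e have feas: "kl_feasible p \<epsilon> ?q" by (simp add: kl_feasible_def)
  have "g $ u * ?q $ u = g $ w * ?q $ u" for u
    using w by (auto simp: q maximizers_iff intro: antisym)
  then have value_q: "g \<bullet> ?q = g $ w"
    by (simp only: inner_vec_def inner_real_def sum mult_1_right flip: sum_distrib_left)
  \<comment> \<open>An average of \<open>g\<close> never exceeds its maximum, so \<open>?q\<close>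
    is optimal even among all probability vectors.\<close>
  have "g \<bullet> r \<le> g $ w" if "r \<in> prob_vectors" for r
  proof -
    have "g \<bullet> r \<le> (\<Sum>u\<in>UNIV. g $ w * r $ u)"
      unfolding inner_vec_def using that w
      by (auto simp: prob_vectors_def maximizers_iff intro!: sum_mono mult_right_mono)
    then show ?thesis using that by (simp add: prob_vectors_def flip: sum_distrib_left)
  qed
  with feas value_q show ?thesis
    by (auto simp: kl_optimal_def is_arg_max_def not_less kl_feasible_def)
qed

text \<open>The equivalence with \<open>q = tilt p g \<delta>\<close> expresses existence and
  uniqueness of the optimizer at once.\<close>

theorem theoremD1:
  fixes p g :: "real ^ 'a" and \<epsilon> :: real
  assumes "p \<in> prob_vectors"
    and "full_support p"
    and "\<not> (\<exists>c. \<forall>u. g $ u = c)"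
    and "0 < \<epsilon>"
  shows "(\<epsilon> < eps_max p g \<longrightarrow>
            (\<exists>!\<delta>. 0 < \<delta> \<and> KL (tilt p g \<delta>) p = \<epsilon>) \<and>
            (\<forall>\<delta>. 0 < \<delta> \<and> KL (tilt p g \<delta>) p = \<epsilon> \<longrightarrow>
              (\<forall>q. kl_optimal p g \<epsilon> q \<longleftrightarrow> q = tilt p g \<delta>)))
       \<and> (eps_max p g \<le> \<epsilon> \<longrightarrow> kl_optimal p g \<epsilon> (tilt_infinity p g))"
  using ex1_tilt_KL_eq[OF assms] kl_optimal_iff_eq_tilt[OF assms(2)]
    kl_optimal_tilt_infinity[OF assms(2)]
  by blast

end
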